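(* Put $c_n:=w_{n+1}\frac{b_n}{a_n}-w_n\frac{b_{n-1}}{a_{n-1}}$ for $n\ge 1$. If $$\sup_{n\geq 1}\Big\{\Big|\frac{w_{n+1}a_{n+1}}{a_n}\Big|,\ |c_n|\Big\}<\infty$$ and $$\sum_{n=1}^{\infty}\max\left\{\left|\frac{w_1b_0^2b_1\cdots b_{n-1}}{a_0a_1\cdots a_n}\right|,\ \sup_{j\ge 1}\left|\frac{c_jb_jb_{j+1}\cdots b_{j+n-1}}{a_{j+1}a_{j+2}\cdots a_{j+n}}\right|\right\}<\infty$$ (for $n=1$ the first quantity in the maximum is $|w_1b_0^2/(a_0a_1)|$), then $B_w$ is bounded on $\ell^p_{a,b}$ for every $1\le p<\infty$, and on $c_{0,a,b}$.
   Context: $\mathbb{D}$ is the open unit disc in $\mathbb{C}$. $a=(a_n)_{n\ge0}$ and $b=(b_n)_{n\ge0}$ are complex sequences with $a_n\ne0$ for all $n$, and $f_n(z)=(a_n+b_nz)z^n$, $n\ge0$. For $1\le p<\infty$, $\ell^p_{a,b}$ is the Banach space of analytic functions on $\mathbb{D}$ of the form $f=\sum_{n\ge0}\lambda_nf_n$ with $(\lambda_n)\in\ell^p$, normed by $\|f\|=(\sum_n|\lambda_n|^p)^{1/p}$ (so $\{f_n\}$ is a normalized Schauder basis equivalent to the standard basis of $\ell^p$, and an orthonormal basis when $p=2$). $c_{0,a,b}$ is the Banach space of analytic functions $f=\sum_{n\ge0}\lambda_nf_n$ on $\mathbb{D}$ with $\lambda_n\to0$, normed by $\|f\|=\sup_n|\lambda_n|$.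 Standing assumption: each of the sets $\mathcal D_1=\{z\in\mathbb{C}:\sum_n((|a_n|+|b_n|)|z|^n)^q<\infty\}$ (with $1/p+1/q=1$, relevant for $1<p<\infty$), $\mathcal D_2=\{z\in\mathbb{C}:\sup_n(|a_n|+|b_n|)|z|^n<\infty\}$ (relevant for $p=1$) and $\mathcal D_3=\{z\in\mathbb{C}:\sum_n(|a_n|+|b_n|)|z|^n<\infty\}$ (relevant for $c_{0,a,b}$) equals $\mathbb{D}$. $w=(w_n)_{n\ge0}$ is a sequence of non-zero complex numbers, and the weighted backward shift acts on Taylor series by $B_w(\sum_{n\ge0}\lambda_nz^n)=\sum_{n\ge0}w_{n+1}\lambda_{n+1}z^n$. *)

theory Defs
  imports "HOL-Complex_Analysis.Complex_Analysis"
begin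

definition basis_fun :: "(nat \<Rightarrow> complex) \<Rightarrow> (nat \<Rightarrow> complex) \<Rightarrow> nat \<Rightarrow> complex \<Rightarrow> complex" where
  "basis_fun a b n z = (a n + b n * z) * z ^ n"

definition lp_seq :: "real \<Rightarrow> (nat \<Rightarrow> complex) set" where
  "lp_seq p = {l. summable (\<lambda>n. norm (l n) powr p)}"

definition c0_seq :: "(nat \<Rightarrow> complex) set" where
  "c0_seq = {l. l \<longlonglongrightarrow> 0}"

definition represents ::
  "(nat \<Rightarrow> complex) \<Rightarrow> (nat \<Rightarrow> complex) \<Rightarrow> (nat \<Rightarrow> complex) \<Rightarrow> (complex \<Rightarrow> complex) \<Rightarrow> bool" where
  "represents a b l f \<longleftrightarrow> (\<forall>z\<in>ball 0 1. (\<lambda>n. l n * basis_fun a b n z) sums f z)"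

(* Analytic functions on the unit disc are encoded as total functions that vanish off the disc,
   so that equality of functions is equality on the disc. S is the space of admissible
   coefficient sequences. *)
definition basis_space ::
  "(nat \<Rightarrow> complex) set \<Rightarrow> (nat \<Rightarrow> complex) \<Rightarrow> (nat \<Rightarrow> complex) \<Rightarrow> (complex \<Rightarrow> complex) set" where
  "basis_space S a b =
     {f. f holomorphic_on ball 0 1 \<and> (\<forall>z. z \<notin> ball 0 1 \<longrightarrow> f z = 0) \<and>
         (\<exists>l\<in>S. represents a b l f)}"

(* The coefficient sequence is unique for the sequence spaces used here, because every a n is
   non-zero and the domain condition on a, b (below) makes the series converge absolutely
   and locally uniformly on the disc. *)
definition basis_coeffs ::
  "(nat \<Rightarrow> complex) set \<Rightarrow> (nat \<Rightarrow> complex) \<Rightarrow> (nat \<Rightarrow> complex) \<Rightarrow> (complex \<Rightarrow> complex) \<Rightarrow> nat \<Rightarrow> complex" where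
  "basis_coeffs S a b f = (THE l. l \<in> S \<and> represents a b l f)"

definition lp_space :: "real \<Rightarrow> (nat \<Rightarrow> complex) \<Rightarrow> (nat \<Rightarrow> complex) \<Rightarrow> (complex \<Rightarrow> complex) set" where
  "lp_space p a b = basis_space (lp_seq p) a b"

definition lp_norm :: "real \<Rightarrow> (nat \<Rightarrow> complex) \<Rightarrow> (nat \<Rightarrow> complex) \<Rightarrow> (complex \<Rightarrow> complex) \<Rightarrow> real" where
  "lp_norm p a b f = (\<Sum>n. norm (basis_coeffs (lp_seq p) a b f n) powr p) powr (1 / p)"

definition c0_space :: "(nat \<Rightarrow> complex) \<Rightarrow> (nat \<Rightarrow> complex) \<Rightarrow> (complex \<Rightarrow> complex) set" where
  "c0_space a b = basis_space c0_seq a b"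

definition c0_norm :: "(nat \<Rightarrow> complex) \<Rightarrow> (nat \<Rightarrow> complex) \<Rightarrow> (complex \<Rightarrow> complex) \<Rightarrow> real" where
  "c0_norm a b f = (SUP n. norm (basis_coeffs c0_seq a b f n))"

(* The natural domains of the evaluation functionals on the spaces for 1 < p (with q the
   conjugate exponent), for p = 1, and for c_0. *)
definition dom_lp :: "real \<Rightarrow> (nat \<Rightarrow> complex) \<Rightarrow> (nat \<Rightarrow> complex) \<Rightarrow> complex set" where
  "dom_lp q a b = {z. summable (\<lambda>n. ((norm (a n) + norm (b n)) * norm z ^ n) powr q)}"

definition dom_l1 :: "(nat \<Rightarrow> complex) \<Rightarrow> (nat \<Rightarrow> complex) \<Rightarrow> complex set" where
  "dom_l1 a b = {z. bdd_above (range (\<lambda>n. (norm (a n) + norm (b n)) * norm z ^ n))}"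

definition dom_c0 :: "(nat \<Rightarrow> complex) \<Rightarrow> (nat \<Rightarrow> complex) \<Rightarrow> complex set" where
  "dom_c0 a b = {z. summable (\<lambda>n. (norm (a n) + norm (b n)) * norm z ^ n)}"

definition shift_fps :: "(nat \<Rightarrow> complex) \<Rightarrow> complex fps \<Rightarrow> complex fps" where
  "shift_fps w F = Abs_fps (\<lambda>n. w (Suc n) * fps_nth F (Suc n))"

(* The values are meaningful only if the shifted Taylor series converges on the disc;
   bounded_shift_on demands this. *)
definition backward_shift :: "(nat \<Rightarrow> complex) \<Rightarrow> (complex \<Rightarrow> complex) \<Rightarrow> complex \<Rightarrow> complex" where
  "backward_shift w f z =
     (if z \<in> ball 0 1 then eval_fps (shift_fps w (fps_expansion f 0)) z else 0)"

definition bounded_operator_on ::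
  "(complex \<Rightarrow> complex) set \<Rightarrow> ((complex \<Rightarrow> complex) \<Rightarrow> real) \<Rightarrow>
   ((complex \<Rightarrow> complex) \<Rightarrow> complex \<Rightarrow> complex) \<Rightarrow> bool" where
  "bounded_operator_on X N T \<longleftrightarrow>
     (\<forall>f\<in>X. T f \<in> X) \<and>
     (\<forall>f\<in>X. \<forall>g\<in>X. T (\<lambda>z. f z + g z) = (\<lambda>z. T f z + T g z)) \<and>
     (\<forall>f\<in>X. \<forall>k. T (\<lambda>z. k * f z) = (\<lambda>z. k * T f z)) \<and>
     (\<exists>C. \<forall>f\<in>X. N (T f) \<le> C * N f)"

definition bounded_shift_on ::
  "(nat \<Rightarrow> complex) \<Rightarrow> (complex \<Rightarrow> complex) set \<Rightarrow> ((complex \<Rightarrow> complex) \<Rightarrow> real) \<Rightarrow> bool" where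
  "bounded_shift_on w X N \<longleftrightarrow>
     (\<forall>f\<in>X. fps_conv_radius (shift_fps w (fps_expansion f 0)) \<ge> 1) \<and>
     bounded_operator_on X N (backward_shift w)"

(* Only used for n \<ge> 1, where the truncated subtraction is harmless. *)
definition c_seq ::
  "(nat \<Rightarrow> complex) \<Rightarrow> (nat \<Rightarrow> complex) \<Rightarrow> (nat \<Rightarrow> complex) \<Rightarrow> nat \<Rightarrow> complex" where
  "c_seq a b w n = w (n + 1) * (b n / a n) - w n * (b (n - 1) / a (n - 1))"

(* The n-th term (n \<ge> 1) of the series in the hypothesis, as an extended real since the
   supremum may be infinite. *)
definition max_term ::
  "(nat \<Rightarrow> complex) \<Rightarrow> (nat \<Rightarrow> complex) \<Rightarrow> (nat \<Rightarrow> complex) \<Rightarrow> nat \<Rightarrow> ennreal" where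
  "max_term a b w n =
     max (ennreal (norm (w 1 * (b 0)^2 * (\<Prod>i=1..<n. b i) / (\<Prod>i=0..n. a i))))
         (SUP j\<in>{1..}. ennreal (norm (c_seq a b w j * (\<Prod>i=j..<j+n. b i) / (\<Prod>i=j+1..j+n. a i))))"

end

theory Submission
  imports Defs
begin

text \<open>
  If \<open>f = \<Sum>n. l n * f\<^sub>n\<close>, then the Taylor coefficients of \<open>f\<close> are
  \<open>l n * a n + l (n - 1) * b (n - 1)\<close>. Solving the same recursion for \<open>B\<^sub>w f\<close> shows that its
  coefficients are \<open>w (n + 1) * a (n + 1) / a n * l (n + 1)\<close> plus a lower triangular term
  whose entry on the \<open>k\<close>-th subdiagonal is bounded by the \<open>k\<close>-th term of the series in the
  hypothesis. So the coefficients of \<open>B\<^sub>w f\<close> are dominated by a convolution of \<open>\<bar>l\<bar>\<close> with a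
  summable sequence, and Young's convolution inequality (for \<open>l\<^sup>p\<close>) and Tannery's theorem
  (for \<open>c\<^sub>0\<close>) apply.
\<close>

section \<open>Convolution with a summable sequence\<close>

text \<open>For two positive points this is \<open>powr_convex\<close>. The endpoint 0 is included
  because coefficients may vanish; there convexity reduces to \<open>t powr p \<le> t\<close> for
  \<open>0 < t < 1\<close>.\<close>

lemma convex_on_powr_nonneg:
  fixes p :: real
  assumes "1 \<le> p"
  shows "convex_on {0..} (\<lambda>x. x powr p)"
proof (rule convex_onI)
  have scale: "(t * x) powr p \<le> t * x powr p" if "0 < t" "t < 1" "0 \<le> x" for t x :: real
  proof -
    have "t powr p \<le> t powr 1"
      using that assms by (intro powr_mono') auto
    then show ?thesis
      using that by (simp add: powr_mult mult_right_mono)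
  qed
  fix t x y :: real
  assume t: "0 < t" "t < 1" and xy: "x \<in> {0..}" "y \<in> {0..}"
  consider "x = 0" | "y = 0" | "0 < x" "0 < y"
    using xy by fastforce
  then show "((1 - t) *\<^sub>R x + t *\<^sub>R y) powr p \<le> (1 - t) * x powr p + t * y powr p"
  proof cases
    case 1
    then show ?thesis using scale[of t y] t xy by simp
  next
    case 2
    then show ?thesis using scale[of "1 - t" x] t xy by simp
  next
    case 3
    then show ?thesis
      using convex_onD[OF powr_convex[OF assms], of t x y] t by simp
  qed
qed simp

text \<open>Jensen's inequality for the probability weights \<open>W i / s\<close> with
  \<open>s = sum W A\<close>. Undoing the normalisation costs \<open>s powr p\<close> on the left
  and gains \<open>1 / s\<close> on the right, whence the exponent \<open>p - 1\<close>.\<close>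

lemma Jensen_powr_sum:
  fixes W x :: "'i \<Rightarrow> real"
  assumes "1 \<le> p" "finite A" "\<And>i. i \<in> A \<Longrightarrow> 0 \<le> W i" "\<And>i. i \<in> A \<Longrightarrow> 0 \<le> x i"
    and pos: "0 < sum W A"
  shows "(\<Sum>i\<in>A. W i * x i) powr p \<le> sum W A powr (p - 1) * (\<Sum>i\<in>A. W i * x i powr p)"
proof -
  define s where "s = sum W A"
  have s: "0 < s" using pos by (simp add: s_def)
  have "(\<Sum>i\<in>A. (W i / s) *\<^sub>R x i) powr p \<le> (\<Sum>i\<in>A. (W i / s) * x i powr p)"
  proof (rule convex_on_sum[OF \<open>finite A\<close> _ convex_on_powr_nonneg[OF \<open>1 \<le> p\<close>]])
    show "A \<noteq> {}" using pos by auto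
    show "(\<Sum>i\<in>A. W i / s) = 1" using s by (simp add: sum_divide_distrib[symmetric] s_def)
  qed (use assms s in auto)
  then have J: "((\<Sum>i\<in>A. W i * x i) / s) powr p \<le> (\<Sum>i\<in>A. W i * x i powr p) / s"
    by (simp add: sum_divide_distrib)
  have "(\<Sum>i\<in>A. W i * x i) powr p = s powr p * ((\<Sum>i\<in>A. W i * x i) / s) powr p"
    using s assms by (simp add: powr_mult[symmetric] sum_nonneg)
  also have "\<dots> \<le> s powr p * ((\<Sum>i\<in>A. W i * x i powr p) / s)"
    by (intro mult_left_mono J) simp
  also have "\<dots> = s powr (p - 1) * (\<Sum>i\<in>A. W i * x i powr p)"
    using s by (simp add: powr_diff)
  finally show ?thesis by (simp add: s_def)
qed

text \<open>Young's inequality for the convolution of a summable sequence with an l^p sequence.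
  Jensen at each \<open>k\<close> bounds \<open>y k\<close> by \<open>T powr (p - 1)\<close> times
  the Cauchy product \<open>z k\<close> of \<open>W\<close> and \<open>x powr p\<close>, whose total
  is \<open>T\<close> times the sum of \<open>x i powr p\<close>. The condition
  \<open>0 < W 0\<close> keeps the partial weight sums positive, as Jensen requires.\<close>

lemma Young_convolution:
  fixes W x :: "nat \<Rightarrow> real"
  assumes p: "1 \<le> p" and W: "summable W" "\<And>i. 0 \<le> W i" "0 < W 0"
    and x: "\<And>i. 0 \<le> x i" "summable (\<lambda>i. x i powr p)"
  defines "y \<equiv> \<lambda>k. (\<Sum>i\<le>k. W i * x (k - i)) powr p"
  shows "summable y" and "suminf y \<le> suminf W powr p * (\<Sum>i. x i powr p)"
proof -
  define T where "T = suminf W"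
  have T: "0 < T"
    unfolding T_def by (rule suminf_pos2[OF W(1), of 0]) (use W in auto)
  define z where "z k = (\<Sum>i\<le>k. W i * x (k - i) powr p)" for k
  have z: "z sums (T * (\<Sum>i. x i powr p))"
    unfolding z_def T_def by (rule Cauchy_product_sums) (use W x in auto)
  have y_le: "y k \<le> T powr (p - 1) * z k" for k
  proof -
    have "W 0 \<le> sum W {..k}"
      by (rule member_le_sum) (use W in auto)
    then have pos: "0 < sum W {..k}"
      using W(3) by linarith
    have "sum W {..k} \<le> T"
      unfolding T_def by (rule sum_le_suminf) (use W in auto)
    then have "sum W {..k} powr (p - 1) \<le> T powr (p - 1)"
      using pos p by (intro powr_mono2) auto
    moreover have "0 \<le> z k"
      unfolding z_def by (intro sum_nonneg) (use W in auto)
    ultimately show ?thesis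
      using Jensen_powr_sum[of p "{..k}" W "\<lambda>i. x (k - i)"] p W x pos
      unfolding y_def z_def by (meson finite_atMost mult_right_mono order_trans)
  qed
  have sz: "(\<lambda>k. T powr (p - 1) * z k) sums (T powr (p - 1) * (T * (\<Sum>i. x i powr p)))"
    by (rule sums_mult[OF z])
  show "summable y"
    by (rule summable_comparison_test'[OF sums_summable[OF sz], of 0])
       (use y_le in \<open>auto simp: y_def\<close>)
  then have "suminf y \<le> (\<Sum>k. T powr (p - 1) * z k)"
    using y_le sums_summable[OF sz] by (intro suminf_le)
  also have "\<dots> = T powr p * (\<Sum>i. x i powr p)"
    using sums_unique[OF sz] T by (simp add: powr_diff)
  finally show "suminf y \<le> suminf W powr p * (\<Sum>i. x i powr p)"
    by (simp add: T_def)
qed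

text \<open>Tannery's theorem with summation index \<open>i\<close>: for fixed \<open>i\<close> the
  term \<open>W i * x (k - i)\<close> tends to 0, and \<open>B * W i\<close> dominates it uniformly
  in \<open>k\<close>.\<close>

lemma convolution_tendsto_0:
  fixes W x :: "nat \<Rightarrow> real"
  assumes W: "summable W" "\<And>i. 0 \<le> W i" and x: "x \<longlonglongrightarrow> 0"
  shows "(\<lambda>k. \<Sum>i\<le>k. W i * x (k - i)) \<longlonglongrightarrow> 0"
proof -
  obtain B where B: "\<And>n. norm (x n) \<le> B"
    using convergent_imp_Bseq[OF convergentI[OF x]] unfolding Bseq_def by blast
  have B0: "0 \<le> B"
    using B[of 0] norm_ge_zero order_trans by blast
  \<comment> \<open>Extension by zero turns the growing finite sums into series over one index
    set.\<close>
  define F where "F i k = (if i \<le> k then W i * x (k - i) else 0)" for i k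
  have "((\<lambda>k. \<Sum>i. F i k) \<longlongrightarrow> (\<Sum>i. 0)) sequentially"
  proof (rule tannerys_theorem[THEN conjunct2, THEN conjunct2])
    show "((\<lambda>k. F i k) \<longlongrightarrow> 0) sequentially" for i
    proof (rule LIMSEQ_offset[of _ i])
      show "(\<lambda>n. F i (n + i)) \<longlonglongrightarrow> 0"
        unfolding F_def using tendsto_mult_left[OF x, of "W i"] by simp
    qed
    show "\<forall>\<^sub>F (i, k) in at_top \<times>\<^sub>F sequentially. norm (F i k) \<le> B * W i"
      using B B0 W
      by (intro always_eventually)
         (auto simp: F_def abs_mult mult.commute[of B] intro!: mult_left_mono)
    show "summable (\<lambda>i. B * W i)"
      using W by (intro summable_mult)
  qed simp
  moreover have "(\<Sum>i. F i k) = (\<Sum>i\<le>k. W i * x (k - i))" for k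
    by (subst suminf_finite[of "{..k}"]) (auto simp: F_def)
  ultimately show ?thesis by simp
qed

section \<open>Coefficients of the shifted function\<close>

definition taylor_coeffs ::
  "(nat \<Rightarrow> complex) \<Rightarrow> (nat \<Rightarrow> complex) \<Rightarrow> (nat \<Rightarrow> complex) \<Rightarrow> nat \<Rightarrow> complex" where
  "taylor_coeffs a b l n = l n * a n + (if n = 0 then 0 else l (n - 1) * b (n - 1))"

text \<open>The part of the coefficients of \<open>B_w f\<close> on and below the diagonal. In the
  recursion for those coefficients, the superdiagonal term at index \<open>n\<close>, multiplied by
  \<open>b n\<close>, joins the term \<open>w (n + 2) * b (n + 1) * l (n + 1)\<close>; together,
  divided by \<open>a (n + 1)\<close>, they produce the factor
  \<open>c_seq a b w (Suc n)\<close>.\<close>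

primrec lower_coeffs ::
  "(nat \<Rightarrow> complex) \<Rightarrow> (nat \<Rightarrow> complex) \<Rightarrow> (nat \<Rightarrow> complex) \<Rightarrow> (nat \<Rightarrow> complex) \<Rightarrow> nat \<Rightarrow> complex" where
  "lower_coeffs a b w l 0 = w 1 * b 0 / a 0 * l 0"
| "lower_coeffs a b w l (Suc n) =
     c_seq a b w (Suc n) * l (Suc n) - b n / a (Suc n) * lower_coeffs a b w l n"

definition shift_coeffs ::
  "(nat \<Rightarrow> complex) \<Rightarrow> (nat \<Rightarrow> complex) \<Rightarrow> (nat \<Rightarrow> complex) \<Rightarrow> (nat \<Rightarrow> complex) \<Rightarrow> nat \<Rightarrow> complex" where
  "shift_coeffs a b w l n = w (n + 1) * a (n + 1) / a n * l (n + 1) + lower_coeffs a b w l n"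

text \<open>This is what makes \<open>shift_coeffs\<close> the right candidate: the right-hand side
  is the Taylor coefficient of \<open>B_w f\<close>.\<close>

lemma taylor_coeffs_shift_coeffs:
  assumes "\<And>n. a n \<noteq> 0"
  shows "taylor_coeffs a b (shift_coeffs a b w l) n = w (Suc n) * taylor_coeffs a b l (Suc n)"
proof (cases n)
  case 0
  then show ?thesis
    using assms[of 0] by (simp add: taylor_coeffs_def shift_coeffs_def field_simps)
next
  case (Suc m)
  then show ?thesis
    using assms[of m] assms[of "Suc m"]
    by (simp add: taylor_coeffs_def shift_coeffs_def c_seq_def field_simps)
qed

text \<open>The system is lower triangular with non-zero diagonal entries \<open>a n\<close>, so it
  is solved uniquely by forward substitution.\<close>

lemma taylor_coeffs_inject:
  assumes a: "\<And>n. a n \<noteq> 0" and eq: "taylor_coeffs a b l = taylor_coeffs a b l'"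
  shows "l = l'"
proof
  show "l n = l' n" for n
  proof (induction n)
    case 0
    then show ?case using fun_cong[OF eq, of 0] a[of 0] by (simp add: taylor_coeffs_def)
  next
    case (Suc n)
    then show ?case using fun_cong[OF eq, of "Suc n"] a[of "Suc n"] by (simp add: taylor_coeffs_def)
  qed
qed

text \<open>Unrolling the recursion: \<open>l j\<close> enters at step \<open>j\<close> with factor
  \<open>d j\<close>, and each later step multiplies it by \<open>- b i / a (i + 1)\<close>; the
  signs vanish under the norm. The value \<open>d 0\<close> is separate because the recursion starts
  from \<open>w 1 * b 0 / a 0\<close>, not from \<open>c_seq\<close>.\<close>

lemma norm_lower_coeffs_le:
  fixes a b w l :: "nat \<Rightarrow> complex"
  defines "d \<equiv> \<lambda>j. if j = 0 then w 1 * b 0 / a 0 else c_seq a b w j"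
  shows "norm (lower_coeffs a b w l n) \<le>
    (\<Sum>j\<le>n. norm (d j * (\<Prod>i=j..<n. b i) / (\<Prod>i=j+1..n. a i)) * norm (l j))"
proof (induction n)
  case 0
  then show ?case by (simp add: d_def norm_mult norm_divide)
next
  case (Suc n)
  let ?t = "\<lambda>n j. norm (d j * (\<Prod>i=j..<n. b i) / (\<Prod>i=j+1..n. a i)) * norm (l j)"
  have step: "?t (Suc n) j = norm (b n / a (Suc n)) * ?t n j" if "j \<le> n" for j
    using that by (simp add: norm_mult norm_divide mult_ac)
  have "norm (lower_coeffs a b w l (Suc n)) \<le>
      norm (c_seq a b w (Suc n) * l (Suc n)) + norm (b n / a (Suc n)) * norm (lower_coeffs a b w l n)"
    using norm_triangle_ineq4 by (simp add: norm_mult[symmetric])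
  also have "\<dots> \<le> norm (c_seq a b w (Suc n) * l (Suc n)) + norm (b n / a (Suc n)) * (\<Sum>j\<le>n. ?t n j)"
    by (intro add_left_mono mult_left_mono Suc) simp
  also have "norm (b n / a (Suc n)) * (\<Sum>j\<le>n. ?t n j) = (\<Sum>j\<le>n. ?t (Suc n) j)"
    unfolding sum_distrib_left by (intro sum.cong refl step[symmetric]) simp
  also have "norm (c_seq a b w (Suc n) * l (Suc n)) = ?t (Suc n) (Suc n)"
    by (simp add: d_def norm_mult)
  finally show ?case by (simp add: add.commute)
qed

text \<open>The bounds on the matrix entries depend only on the distance from the diagonal, so one
  sequence \<open>W\<close>, independent of \<open>l\<close>, serves all rows. The superdiagonal
  reaches \<open>l (k + 1)\<close>, hence the convolution is taken at \<open>Suc k\<close>.\<close>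

lemma shift_coeffs_le_convolution:
  assumes bdd: "bdd_above (\<Union>n\<in>{1..}. {norm (w (n + 1) * a (n + 1) / a n), norm (c_seq a b w n)})"
    and fin: "(\<Sum>n. max_term a b w (n + 1)) < \<infinity>"
  obtains W where "summable W" "\<And>i. 0 \<le> W i" "0 < W 0"
    "\<And>l k. norm (shift_coeffs a b w l k) \<le> (\<Sum>i\<le>Suc k. W i * norm (l (Suc k - i)))"
proof -
  obtain K where K: "\<And>n. 1 \<le> n \<Longrightarrow> norm (w (n + 1) * a (n + 1) / a n) \<le> K"
      "\<And>n. 1 \<le> n \<Longrightarrow> norm (c_seq a b w n) \<le> K"
    using bdd unfolding bdd_above_def by auto
  \<comment> \<open>\<open>enn2real\<close> sends infinity to 0, so \<open>M\<close> is faithful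
    only because \<open>fin_term\<close> shows every term finite.\<close>
  define M where "M n = enn2real (max_term a b w n)" for n
  \<comment> \<open>\<open>K\<close> controls the superdiagonal and the diagonal from row 1 on; the
    last two summands cover row 0, and the 1 makes \<open>W 0\<close> positive.\<close>
  define A where "A = 1 + \<bar>K\<bar> + norm (w 1 * a 1 / a 0) + norm (w 1 * b 0 / a 0)"
  \<comment> \<open>\<open>W 0\<close> belongs to the superdiagonal, \<open>W 1\<close> to the
    diagonal, and \<open>W (n + 1)\<close> with \<open>n \<ge> 1\<close> to the \<open>n\<close>-th
    subdiagonal.\<close>
  define W where "W i = (if i \<le> 1 then A else M (i - 1))" for i
  have A: "0 < A"
    unfolding A_def by (intro add_pos_nonneg) auto
  have fin_term: "max_term a b w n < \<infinity>" if "1 \<le> n" for n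
    using ennreal_suminf_lessD[OF fin, of "n - 1"] that by simp
  have M_summable: "summable (\<lambda>n. M (n + 1))"
  proof (rule summable_suminf_not_top)
    have "(\<Sum>n. ennreal (M (n + 1))) = (\<Sum>n. max_term a b w (n + 1))"
      using fin_term by (intro suminf_cong) (auto simp: M_def)
    then show "(\<Sum>n. ennreal (M (n + 1))) \<noteq> top"
      using fin by auto
  qed (simp add: M_def)
  have W_summable: "summable W"
    using M_summable summable_iff_shift[of W 2] by (simp add: W_def)
  have le_M: "norm u \<le> M n" if "1 \<le> n" "ennreal (norm u) \<le> max_term a b w n" for u :: complex and n
    unfolding M_def using enn2real_mono[OF that(2)] fin_term[OF that(1)] by simp
  define d where "d j = (if j = 0 then w 1 * b 0 / a 0 else c_seq a b w j)" for j
  have kernel: "norm (d j * (\<Prod>i=j..<k. b i) / (\<Prod>i=j+1..k. a i)) \<le> W (Suc (k - j))"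
    if "j \<le> k" for j k
  proof (cases "j = k")
    case True
    have "norm (d k) \<le> A"
    proof (cases "k = 0")
      case False
      then have "norm (d k) \<le> \<bar>K\<bar>"
        using K(2)[of k] by (auto simp: d_def)
      then show ?thesis
        unfolding A_def by (smt (verit) norm_ge_zero)
    qed (simp add: d_def A_def)
    with True show ?thesis
      by (simp add: W_def)
  next
    case False
    with that have k: "k = j + (k - j)" "1 \<le> k - j" by auto
    have "norm (d j * (\<Prod>i=j..<k. b i) / (\<Prod>i=j+1..k. a i)) \<le> M (k - j)"
    proof (rule le_M[OF k(2)], cases "j = 0")
      case True
      \<comment> \<open>In column 0 the factor \<open>b 0 / a 0\<close> of \<open>d 0\<close>
        supplies the square of \<open>b 0\<close> and the missing \<open>a 0\<close>, which gives
        the first entry of the maximum.\<close>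
      then have "d j * (\<Prod>i=j..<k. b i) / (\<Prod>i=j+1..k. a i)
          = w 1 * (b 0)^2 * (\<Prod>i=1..<k. b i) / (\<Prod>i=0..k. a i)"
        using k by (simp add: d_def prod.atLeast_Suc_lessThan[of 0 k] prod.atLeast_Suc_atMost[of 0 k]
            power2_eq_square)
      then show "ennreal (norm (d j * (\<Prod>i=j..<k. b i) / (\<Prod>i=j+1..k. a i))) \<le> max_term a b w (k - j)"
        using True by (simp add: max_term_def)
    next
      case False
      \<comment> \<open>For \<open>j \<ge> 1\<close> the entry is the \<open>j\<close>-th member of
        the supremum belonging to the distance \<open>k - j\<close>.\<close>
      then have "ennreal (norm (d j * (\<Prod>i=j..<k. b i) / (\<Prod>i=j+1..k. a i)))
          \<le> (SUP j'\<in>{1..}. ennreal (norm (c_seq a b w j' * (\<Prod>i=j'..<j'+(k-j). b i)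
               / (\<Prod>i=j'+1..j'+(k-j). a i))))"
        using k(1) by (intro SUP_upper2[of j]) (auto simp: d_def)
      then show "ennreal (norm (d j * (\<Prod>i=j..<k. b i) / (\<Prod>i=j+1..k. a i))) \<le> max_term a b w (k - j)"
        unfolding max_term_def by (rule max.coboundedI2)
    qed
    then show ?thesis
      using False that by (simp add: W_def)
  qed
  have "norm (shift_coeffs a b w l k) \<le> (\<Sum>i\<le>Suc k. W i * norm (l (Suc k - i)))" for l k
  proof -
    have "norm (w (k + 1) * a (k + 1) / a k) \<le> W 0"
    proof (cases "k = 0")
      case False
      then have "norm (w (k + 1) * a (k + 1) / a k) \<le> \<bar>K\<bar>"
        using K(1)[of k] by auto
      then have "norm (w (k + 1) * a (k + 1) / a k) \<le> A"
        unfolding A_def by (smt (verit) norm_ge_zero)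
      then show ?thesis by (simp add: W_def)
    qed (simp add: W_def A_def)
    then have 1: "norm (w (k + 1) * a (k + 1) / a k * l (k + 1)) \<le> W 0 * norm (l (Suc k))"
      using mult_right_mono[OF _ norm_ge_zero[of "l (Suc k)"]] by (simp only: norm_mult Suc_eq_plus1)
    have "norm (lower_coeffs a b w l k) \<le>
        (\<Sum>j\<le>k. norm (d j * (\<Prod>i=j..<k. b i) / (\<Prod>i=j+1..k. a i)) * norm (l j))"
      unfolding d_def by (rule norm_lower_coeffs_le)
    also have "\<dots> \<le> (\<Sum>j\<le>k. W (Suc (k - j)) * norm (l j))"
      by (intro sum_mono mult_right_mono kernel) auto
    also have "\<dots> = (\<Sum>i\<le>k. W (Suc i) * norm (l (k - i)))"
      by (rule sum.reindex_bij_witness[of _ "\<lambda>i. k - i" "\<lambda>i. k - i"]) auto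
    finally have "norm (shift_coeffs a b w l k) \<le>
        W 0 * norm (l (Suc k)) + (\<Sum>i\<le>k. W (Suc i) * norm (l (k - i)))"
      unfolding shift_coeffs_def using 1 norm_triangle_mono by blast
    then show ?thesis
      by (subst sum.atMost_Suc_shift) simp
  qed
  with that[of W] show thesis
    using W_summable A by (auto simp: W_def M_def)
qed

section \<open>From coefficient sequences to functions\<close>

text \<open>This summability is all that the domain conditions are needed for.\<close>

definition disc_summable ::
  "(nat \<Rightarrow> complex) \<Rightarrow> (nat \<Rightarrow> complex) \<Rightarrow> (nat \<Rightarrow> complex) \<Rightarrow> bool" where
  "disc_summable a b l \<longleftrightarrow>
     (\<forall>z\<in>ball (0 :: complex) 1. summable (\<lambda>n. norm (l n) * ((norm (a n) + norm (b n)) * norm z ^ n)))"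

text \<open>Both series split into the absolutely convergent series of
  \<open>l n * a n * z ^ n\<close> and \<open>z\<close> times that of
  \<open>l n * b n * z ^ n\<close>. Collecting powers of \<open>z\<close> only shifts the second one
  by an index, so the sums agree.\<close>

lemma disc_summable_sums:
  assumes "disc_summable a b l" "norm z < 1"
  shows "\<exists>s. (\<lambda>n. l n * basis_fun a b n z) sums s \<and> (\<lambda>n. taylor_coeffs a b l n * z ^ n) sums s"
proof -
  have S: "summable (\<lambda>n. norm (l n) * ((norm (a n) + norm (b n)) * norm z ^ n))"
    using assms by (simp add: disc_summable_def)
  have "summable (\<lambda>n. l n * a n * z ^ n)"
    by (rule summable_comparison_test'[OF S, of 0])
       (auto simp: norm_mult norm_power mult.assoc intro!: mult_left_mono mult_right_mono)
  then obtain A where A: "(\<lambda>n. l n * a n * z ^ n) sums A"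
    by (auto simp: summable_def)
  have "summable (\<lambda>n. l n * b n * z ^ n)"
    by (rule summable_comparison_test'[OF S, of 0])
       (auto simp: norm_mult norm_power mult.assoc intro!: mult_left_mono mult_right_mono)
  then obtain B where "(\<lambda>n. l n * b n * z ^ n) sums B"
    by (auto simp: summable_def)
  then have B: "(\<lambda>n. z * (l n * b n * z ^ n)) sums (z * B)"
    by (rule sums_mult)
  define g where "g n = (if n = 0 then 0 else l (n - 1) * b (n - 1)) * z ^ n" for n
  have "(\<lambda>n. g (Suc n)) sums (z * B)"
    using B by (simp add: g_def mult_ac)
  then have "g sums (z * B)"
    by (subst (asm) sums_Suc_iff) (simp add: g_def)
  from sums_add[OF A this] have "(\<lambda>n. taylor_coeffs a b l n * z ^ n) sums (A + z * B)"
    by (simp add: g_def taylor_coeffs_def algebra_simps)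
  moreover from sums_add[OF A B] have "(\<lambda>n. l n * basis_fun a b n z) sums (A + z * B)"
    by (simp add: basis_fun_def algebra_simps)
  ultimately show ?thesis by blast
qed

lemma fps_conv_radius_ge_1I:
  fixes t :: "nat \<Rightarrow> complex"
  assumes "\<And>z. norm z < 1 \<Longrightarrow> summable (\<lambda>n. t n * z ^ n)"
  shows "fps_conv_radius (Abs_fps t) \<ge> 1"
  unfolding fps_conv_radius_def
  by (rule conv_radius_geI_ex') (use assms in auto)

text \<open>After regrouping, \<open>f\<close> is the sum of a power series on the disc. Its Taylor
  coefficients and holomorphy follow from that alone, without uniform convergence of the basis
  expansion.\<close>

lemma represents_expansion:
  assumes adm: "disc_summable a b l" and rep: "represents a b l f"
  shows "fps_conv_radius (Abs_fps (taylor_coeffs a b l)) \<ge> 1"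
    and "\<And>z. norm z < 1 \<Longrightarrow> eval_fps (Abs_fps (taylor_coeffs a b l)) z = f z"
    and "fps_expansion f 0 = Abs_fps (taylor_coeffs a b l)"
    and "f holomorphic_on ball 0 1"
proof -
  let ?F = "Abs_fps (taylor_coeffs a b l)"
  have sums: "(\<lambda>n. taylor_coeffs a b l n * z ^ n) sums f z" if "norm z < 1" for z
  proof -
    have "(\<lambda>n. l n * basis_fun a b n z) sums f z"
      using rep that by (simp add: represents_def)
    then show ?thesis
      using disc_summable_sums[OF adm that] sums_unique2 by blast
  qed
  show R: "fps_conv_radius ?F \<ge> 1"
    using sums by (intro fps_conv_radius_ge_1I) (auto simp: sums_iff)
  show ev: "eval_fps ?F z = f z" if "norm z < 1" for z
    using sums_unique[OF sums[OF that]] by (simp add: eval_fps_def)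
  have "eventually (\<lambda>z. z \<in> ball (0::complex) 1) (nhds 0)"
    by (rule eventually_nhds_in_open) auto
  then have "eventually (\<lambda>z. eval_fps ?F z = f z) (nhds 0)"
    by eventually_elim (use ev in auto)
  moreover have "0 < fps_conv_radius ?F"
    using R by (rule less_le_trans[rotated]) simp
  ultimately have "f has_fps_expansion ?F"
    by (simp add: has_fps_expansion_def)
  then show "fps_expansion f 0 = ?F"
    by (rule fps_expansion_eqI)
  have "eval_fps ?F holomorphic_on ball 0 1"
  proof (rule holomorphic_on_eval_fps, rule subsetI)
    fix z :: complex assume "z \<in> ball 0 1"
    then have "ereal (norm z) < 1" by simp
    also note R
    finally show "z \<in> eball 0 (fps_conv_radius ?F)" by simp
  qed
  then show "f holomorphic_on ball 0 1"
    by (rule holomorphic_transform) (use ev in auto)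
qed

text \<open>Justifies the definite description: two representing sequences give the same Taylor
  series, and \<open>taylor_coeffs_inject\<close> then identifies them.\<close>

lemma basis_coeffs_eq:
  assumes a: "\<And>n. a n \<noteq> 0" and adm: "\<And>l. l \<in> S \<Longrightarrow> disc_summable a b l"
    and l: "l \<in> S" "represents a b l f"
  shows "basis_coeffs S a b f = l"
  unfolding basis_coeffs_def
proof (rule the_equality)
  fix l' assume l': "l' \<in> S \<and> represents a b l' f"
  then have "Abs_fps (taylor_coeffs a b l') = Abs_fps (taylor_coeffs a b l)"
    using represents_expansion(3)[of a b l f] represents_expansion(3)[of a b l' f] l adm by simp
  then have "taylor_coeffs a b l' = taylor_coeffs a b l"
    by (simp add: fps_eq_iff fun_eq_iff)
  then show "l' = l"
    by (rule taylor_coeffs_inject[OF a])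
qed (use l in auto)

text \<open>The formal identity of Taylor coefficients becomes one of functions because
  \<open>disc_summable\<close> for the shifted coefficients lets the power series be rewritten as a
  convergent basis expansion.\<close>

lemma represents_backward_shift:
  assumes a: "\<And>n. a n \<noteq> 0"
    and adm: "disc_summable a b l" "disc_summable a b (shift_coeffs a b w l)"
    and rep: "represents a b l f"
  shows "shift_fps w (fps_expansion f 0) = Abs_fps (taylor_coeffs a b (shift_coeffs a b w l))"
    and "represents a b (shift_coeffs a b w l) (backward_shift w f)"
proof -
  show eq: "shift_fps w (fps_expansion f 0) = Abs_fps (taylor_coeffs a b (shift_coeffs a b w l))"
    unfolding represents_expansion(3)[OF adm(1) rep] shift_fps_def
    by (rule fps_ext) (simp add: taylor_coeffs_shift_coeffs[OF a])
  show "represents a b (shift_coeffs a b w l) (backward_shift w f)"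
    unfolding represents_def
  proof
    fix z :: complex assume "z \<in> ball 0 1"
    then show "(\<lambda>n. shift_coeffs a b w l n * basis_fun a b n z) sums backward_shift w f z"
      using disc_summable_sums[OF adm(2), of z]
      by (auto simp: backward_shift_def eq eval_fps_def sums_iff)
  qed
qed

section \<open>Linearity, and transfer from coefficient sequences to functions\<close>

lemma lower_coeffs_linear:
  "lower_coeffs a b w (\<lambda>n. l n + l' n) k = lower_coeffs a b w l k + lower_coeffs a b w l' k"
  "lower_coeffs a b w (\<lambda>n. r * l n) k = r * lower_coeffs a b w l k"
  by (induction k) (simp_all add: algebra_simps add_divide_distrib)

lemma shift_coeffs_linear:
  "shift_coeffs a b w (\<lambda>n. l n + l' n) = (\<lambda>n. shift_coeffs a b w l n + shift_coeffs a b w l' n)"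
  "shift_coeffs a b w (\<lambda>n. r * l n) = (\<lambda>n. r * shift_coeffs a b w l n)"
  by (simp_all add: fun_eq_iff shift_coeffs_def lower_coeffs_linear algebra_simps add_divide_distrib)

lemma represents_linear:
  "represents a b l f \<Longrightarrow> represents a b l' g \<Longrightarrow>
     represents a b (\<lambda>n. l n + l' n) (\<lambda>z. f z + g z)"
  "represents a b l f \<Longrightarrow> represents a b (\<lambda>n. r * l n) (\<lambda>z. r * f z)"
  by (auto simp: represents_def distrib_right mult.assoc intro!: sums_add sums_mult)

lemma disc_summable_add:
  assumes "disc_summable a b l" "disc_summable a b l'"
  shows "disc_summable a b (\<lambda>n. l n + l' n)"
  unfolding disc_summable_def
proof
  fix z :: complex assume "z \<in> ball 0 1"
  then have "summable (\<lambda>n. norm (l n) * ((norm (a n) + norm (b n)) * norm z ^ n)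
      + norm (l' n) * ((norm (a n) + norm (b n)) * norm z ^ n))"
    using assms by (intro summable_add) (auto simp: disc_summable_def)
  then show "summable (\<lambda>n. norm (l n + l' n) * ((norm (a n) + norm (b n)) * norm z ^ n))"
    by (rule summable_comparison_test'[of _ 0])
       (auto simp: abs_mult distrib_right[symmetric] intro!: mult_right_mono norm_triangle_ineq)
qed

lemma disc_summable_mult:
  assumes "disc_summable a b l"
  shows "disc_summable a b (\<lambda>n. r * l n)"
  using assms by (auto simp: disc_summable_def norm_mult mult.assoc intro!: summable_mult)

text \<open>Reduces the claim to the sequence map \<open>shift_coeffs\<close>, with
  \<open>\<nu>\<close> the norm on coefficients. For linearity, sums and multiples are handled
  through \<open>disc_summable\<close>, which is closed under both, rather than through
  \<open>S\<close>.\<close>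

lemma bounded_shift_onI:
  assumes a: "\<And>n. a n \<noteq> 0"
    and adm: "\<And>l. l \<in> S \<Longrightarrow> disc_summable a b l"
    and inv: "\<And>l. l \<in> S \<Longrightarrow> shift_coeffs a b w l \<in> S"
    and bound: "\<And>l. l \<in> S \<Longrightarrow> \<nu> (shift_coeffs a b w l) \<le> C * \<nu> l"
    and N: "\<And>f. N f = \<nu> (basis_coeffs S a b f)"
  shows "bounded_shift_on w (basis_space S a b) N"
proof -
  let ?U = "shift_coeffs a b w" and ?T = "backward_shift w"
  have outside: "?T f z = 0" if "z \<notin> ball 0 1" for f z
    using that by (simp add: backward_shift_def)
  have ex: "\<exists>l\<in>S. represents a b l f" if "f \<in> basis_space S a b" for f
    using that by (simp add: basis_space_def)
  have rep: "represents a b (?U l) (?T f)"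
    if "disc_summable a b l" "disc_summable a b (?U l)" "represents a b l f" for l f
    using that a by (intro represents_backward_shift)
  \<comment> \<open>Functions with a common representing sequence agree on the disc; vanishing
    outside it upgrades this to equality of total functions.\<close>
  have eqI: "F = G"
    if "represents a b l F" "represents a b l G"
      "\<And>z. z \<notin> ball 0 1 \<Longrightarrow> F z = 0" "\<And>z. z \<notin> ball 0 1 \<Longrightarrow> G z = 0" for l F G
  proof
    show "F z = G z" for z
    proof (cases "z \<in> ball 0 1")
      case True
      with that(1,2) show ?thesis
        unfolding represents_def using sums_unique2 by blast
    qed (simp add: that(3,4))
  qed
  have "fps_conv_radius (shift_fps w (fps_expansion f 0)) \<ge> 1" if "f \<in> basis_space S a b" for f
  proof -
    obtain l where l: "l \<in> S" "represents a b l f" using ex[OF \<open>f \<in> _\<close>] by blast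
    note * = represents_backward_shift[OF a adm[OF l(1)] adm[OF inv[OF l(1)]] l(2)]
    show ?thesis
      unfolding *(1) by (rule represents_expansion(1)[OF adm[OF inv[OF l(1)]] *(2)])
  qed
  moreover have "?T f \<in> basis_space S a b" if "f \<in> basis_space S a b" for f
  proof -
    obtain l where l: "l \<in> S" "represents a b l f" using ex[OF \<open>f \<in> _\<close>] by blast
    have "represents a b (?U l) (?T f)"
      by (rule rep[OF adm[OF l(1)] adm[OF inv[OF l(1)]] l(2)])
    then show ?thesis
      using represents_expansion(4)[of a b "?U l" "?T f"] l adm inv outside
      unfolding basis_space_def by blast
  qed
  moreover have "?T (\<lambda>z. f z + g z) = (\<lambda>z. ?T f z + ?T g z)"
    if fg: "f \<in> basis_space S a b" "g \<in> basis_space S a b" for f g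
  proof -
    obtain l where l: "l \<in> S" "represents a b l f" using ex[OF fg(1)] by blast
    obtain l' where l': "l' \<in> S" "represents a b l' g" using ex[OF fg(2)] by blast
    have "represents a b (?U (\<lambda>n. l n + l' n)) (?T (\<lambda>z. f z + g z))"
    proof (rule rep)
      show "disc_summable a b (\<lambda>n. l n + l' n)"
        using l l' adm by (simp add: disc_summable_add)
      show "disc_summable a b (?U (\<lambda>n. l n + l' n))"
        unfolding shift_coeffs_linear using l l' adm inv by (simp add: disc_summable_add)
      show "represents a b (\<lambda>n. l n + l' n) (\<lambda>z. f z + g z)"
        by (rule represents_linear(1)[OF l(2) l'(2)])
    qed
    moreover have "represents a b (?U (\<lambda>n. l n + l' n)) (\<lambda>z. ?T f z + ?T g z)"
      unfolding shift_coeffs_linear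
      by (rule represents_linear(1)[OF rep[OF adm[OF l(1)] adm[OF inv[OF l(1)]] l(2)]
            rep[OF adm[OF l'(1)] adm[OF inv[OF l'(1)]] l'(2)]])
    ultimately show ?thesis
      by (rule eqI) (auto simp: outside)
  qed
  moreover have "?T (\<lambda>z. k * f z) = (\<lambda>z. k * ?T f z)" if "f \<in> basis_space S a b" for f k
  proof -
    obtain l where l: "l \<in> S" "represents a b l f" using ex[OF \<open>f \<in> _\<close>] by blast
    have "represents a b (?U (\<lambda>n. k * l n)) (?T (\<lambda>z. k * f z))"
    proof (rule rep)
      show "disc_summable a b (\<lambda>n. k * l n)"
        using l adm by (simp add: disc_summable_mult)
      show "disc_summable a b (?U (\<lambda>n. k * l n))"
        unfolding shift_coeffs_linear using l adm inv by (simp add: disc_summable_mult)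
      show "represents a b (\<lambda>n. k * l n) (\<lambda>z. k * f z)"
        by (rule represents_linear(2)[OF l(2)])
    qed
    moreover have "represents a b (?U (\<lambda>n. k * l n)) (\<lambda>z. k * ?T f z)"
      unfolding shift_coeffs_linear
      by (rule represents_linear(2)[OF rep[OF adm[OF l(1)] adm[OF inv[OF l(1)]] l(2)]])
    ultimately show ?thesis
      by (rule eqI) (auto simp: outside)
  qed
  moreover have "N (?T f) \<le> C * N f" if "f \<in> basis_space S a b" for f
  proof -
    obtain l where l: "l \<in> S" "represents a b l f" using ex[OF \<open>f \<in> _\<close>] by blast
    have "represents a b (?U l) (?T f)"
      by (rule rep[OF adm[OF l(1)] adm[OF inv[OF l(1)]] l(2)])
    then have "basis_coeffs S a b (?T f) = ?U l"
      using l inv by (intro basis_coeffs_eq[OF a adm])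
    moreover have "basis_coeffs S a b f = l"
      using l by (intro basis_coeffs_eq[OF a adm])
    ultimately show ?thesis
      using bound l N by simp
  qed
  ultimately show ?thesis
    unfolding bounded_shift_on_def bounded_operator_on_def by blast
qed

section \<open>The sequence spaces\<close>

text \<open>Young's inequality for products gives a termwise summable majorant, in place of
  Hoelder's inequality for series.\<close>

lemma disc_summable_lp:
  assumes pq: "1 < p" "1 / p + 1 / q = 1" and dom: "dom_lp q a b = ball 0 1" and l: "l \<in> lp_seq p"
  shows "disc_summable a b l"
  unfolding disc_summable_def
proof
  have q: "1 < q"
  proof -
    have "1 / q = 1 - 1 / p" using pq by simp
    moreover have "0 < 1 / p" "1 / p < 1" using pq by simp_all
    ultimately have "0 < 1 / q" "1 / q < 1" by linarith+
    then show ?thesis by (simp add: divide_less_eq)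
  qed
  fix z :: complex assume "z \<in> ball 0 1"
  then have "summable (\<lambda>n. ((norm (a n) + norm (b n)) * norm z ^ n) powr q)"
    unfolding dom[symmetric] by (simp add: dom_lp_def)
  then have "summable (\<lambda>n. norm (l n) powr p / p + ((norm (a n) + norm (b n)) * norm z ^ n) powr q / q)"
    using l by (intro summable_add summable_divide) (auto simp: lp_seq_def)
  then show "summable (\<lambda>n. norm (l n) * ((norm (a n) + norm (b n)) * norm z ^ n))"
    by (rule summable_comparison_test'[of _ 0])
       (use Youngs_inequality[OF pq(1) q pq(2)] in auto)
qed

lemma disc_summable_l1:
  assumes dom: "dom_l1 a b = ball 0 1" and l: "l \<in> lp_seq 1"
  shows "disc_summable a b l"
  unfolding disc_summable_def
proof
  fix z :: complex assume "z \<in> ball 0 1"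
  then have "bdd_above (range (\<lambda>n. (norm (a n) + norm (b n)) * norm z ^ n))"
    unfolding dom[symmetric] by (simp add: dom_l1_def)
  then obtain B where B: "\<And>n. (norm (a n) + norm (b n)) * norm z ^ n \<le> B"
    unfolding bdd_above_def by auto
  have "summable (\<lambda>n. norm (l n) * B)"
    using l by (intro summable_mult2) (auto simp: lp_seq_def)
  then show "summable (\<lambda>n. norm (l n) * ((norm (a n) + norm (b n)) * norm z ^ n))"
    by (rule summable_comparison_test'[of _ 0]) (use B in \<open>auto intro!: mult_left_mono\<close>)
qed

text \<open>Boundedness is what makes the real \<open>SUP\<close> in the norm an actual upper
  bound.\<close>

lemma c0_seq_bounded:
  assumes "l \<in> c0_seq"
  shows "bdd_above (range (\<lambda>n. norm (l n)))"
proof -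
  have "Bseq l"
    using assms by (intro convergent_imp_Bseq convergentI[of l 0]) (simp add: c0_seq_def)
  then show ?thesis
    unfolding Bseq_def bdd_above_def by auto
qed

lemma disc_summable_c0:
  assumes dom: "dom_c0 a b = ball 0 1" and l: "l \<in> c0_seq"
  shows "disc_summable a b l"
  unfolding disc_summable_def
proof
  obtain B where B: "\<And>n. norm (l n) \<le> B"
    using c0_seq_bounded[OF l] unfolding bdd_above_def by auto
  fix z :: complex assume "z \<in> ball 0 1"
  then have "summable (\<lambda>n. (norm (a n) + norm (b n)) * norm z ^ n)"
    unfolding dom[symmetric] by (simp add: dom_c0_def)
  then have "summable (\<lambda>n. B * ((norm (a n) + norm (b n)) * norm z ^ n))"
    by (rule summable_mult)
  then show "summable (\<lambda>n. norm (l n) * ((norm (a n) + norm (b n)) * norm z ^ n))"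
    by (rule summable_comparison_test'[of _ 0]) (use B in \<open>auto intro!: mult_right_mono\<close>)
qed

section \<open>Convolution bounds in the norms of l^p and c_0\<close>

lemma lp_convolution_bound:
  fixes u l :: "nat \<Rightarrow> complex"
  assumes p: "1 \<le> p" and W: "summable W" "\<And>i. 0 \<le> W i" "0 < W 0" and l: "l \<in> lp_seq p"
    and u: "\<And>k. norm (u k) \<le> (\<Sum>i\<le>Suc k. W i * norm (l (Suc k - i)))"
  shows "u \<in> lp_seq p"
    and "(\<Sum>n. norm (u n) powr p) powr (1 / p) \<le> suminf W * (\<Sum>n. norm (l n) powr p) powr (1 / p)"
proof -
  define y where "y k = (\<Sum>i\<le>k. W i * norm (l (k - i))) powr p" for k
  have y: "summable y" "suminf y \<le> suminf W powr p * (\<Sum>n. norm (l n) powr p)"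
    using Young_convolution[OF p W, of "\<lambda>n. norm (l n)"] l
    unfolding y_def by (auto simp: lp_seq_def)
  have uy: "norm (u k) powr p \<le> y (Suc k)" for k
    unfolding y_def using p u by (intro powr_mono2) auto
  have yS: "summable (\<lambda>k. y (Suc k))"
    using y(1) by (subst summable_Suc_iff)
  have u_sum: "summable (\<lambda>k. norm (u k) powr p)"
    by (rule summable_comparison_test'[OF yS, of 0]) (use uy in auto)
  then show "u \<in> lp_seq p"
    by (simp add: lp_seq_def)
  have "(\<Sum>k. norm (u k) powr p) \<le> (\<Sum>k. y (Suc k))"
    by (intro suminf_le uy u_sum yS)
  \<comment> \<open>The shift from \<open>k\<close> to \<open>Suc k\<close> only drops the
    non-negative term \<open>y 0\<close>.\<close>
  also have "\<dots> \<le> suminf y"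
    using suminf_split_head[OF y(1)] by (simp add: y_def)
  also note y(2)
  finally have "(\<Sum>n. norm (u n) powr p) powr (1 / p)
      \<le> (suminf W powr p * (\<Sum>n. norm (l n) powr p)) powr (1 / p)"
    using p by (intro powr_mono2 suminf_nonneg u_sum) auto
  also have "\<dots> = suminf W * (\<Sum>n. norm (l n) powr p) powr (1 / p)"
    using p l W by (simp add: powr_mult powr_powr suminf_nonneg lp_seq_def)
  finally show "(\<Sum>n. norm (u n) powr p) powr (1 / p)
      \<le> suminf W * (\<Sum>n. norm (l n) powr p) powr (1 / p)" .
qed

lemma c0_convolution_bound:
  fixes u l :: "nat \<Rightarrow> complex"
  assumes W: "summable W" "\<And>i. 0 \<le> W i" and l: "l \<in> c0_seq"
    and u: "\<And>k. norm (u k) \<le> (\<Sum>i\<le>Suc k. W i * norm (l (Suc k - i)))"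
  shows "u \<in> c0_seq"
    and "(SUP n. norm (u n)) \<le> suminf W * (SUP n. norm (l n))"
proof -
  have "(\<lambda>k. \<Sum>i\<le>k. W i * norm (l (k - i))) \<longlonglongrightarrow> 0"
    using l by (intro convolution_tendsto_0 W) (auto simp: c0_seq_def tendsto_norm_zero)
  then have "(\<lambda>k. \<Sum>i\<le>Suc k. W i * norm (l (Suc k - i))) \<longlonglongrightarrow> 0"
    by (rule LIMSEQ_Suc)
  then have "u \<longlonglongrightarrow> 0"
    by (rule Lim_null_comparison[rotated]) (use u in auto)
  then show "u \<in> c0_seq"
    by (simp add: c0_seq_def)
  define L where "L = (SUP n. norm (l n))"
  have L: "norm (l n) \<le> L" for n
    unfolding L_def by (intro cSUP_upper c0_seq_bounded l) simp
  have L0: "0 \<le> L"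
    using L[of 0] norm_ge_zero order_trans by blast
  have "norm (u k) \<le> suminf W * L" for k
  proof -
    note u
    also have "(\<Sum>i\<le>Suc k. W i * norm (l (Suc k - i))) \<le> (\<Sum>i\<le>Suc k. W i * L)"
      by (intro sum_mono mult_left_mono L W)
    also have "\<dots> = (\<Sum>i\<le>Suc k. W i) * L"
      by (rule sum_distrib_right[symmetric])
    also have "\<dots> \<le> suminf W * L"
      using W L0 by (intro mult_right_mono sum_le_suminf) auto
    finally show ?thesis .
  qed
  then show "(SUP n. norm (u n)) \<le> suminf W * (SUP n. norm (l n))"
    unfolding L_def[symmetric] by (intro cSUP_least) auto
qed

theorem theorem3p3:
  fixes a b w :: "nat \<Rightarrow> complex"
  assumes "\<And>n. a n \<noteq> 0" and "\<And>n. w n \<noteq> 0"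
    and "bdd_above (\<Union>n\<in>{1..}. {norm (w (n + 1) * a (n + 1) / a n), norm (c_seq a b w n)})"
    and "(\<Sum>n. max_term a b w (n + 1)) < \<infinity>"
  shows "(\<forall>p q :: real. 1 < p \<and> 1 / p + 1 / q = 1 \<and> dom_lp q a b = ball 0 1 \<longrightarrow>
            bounded_shift_on w (lp_space p a b) (lp_norm p a b))
       \<and> (dom_l1 a b = ball 0 1 \<longrightarrow> bounded_shift_on w (lp_space 1 a b) (lp_norm 1 a b))
       \<and> (dom_c0 a b = ball 0 1 \<longrightarrow> bounded_shift_on w (c0_space a b) (c0_norm a b))"
proof -
  obtain W where W: "summable W" "\<And>i. 0 \<le> W i" "0 < W 0"
    and U: "\<And>l k. norm (shift_coeffs a b w l k) \<le> (\<Sum>i\<le>Suc k. W i * norm (l (Suc k - i)))"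
    using shift_coeffs_le_convolution[OF assms(3,4)] by blast
  \<comment> \<open>The cases \<open>p = 1\<close> and \<open>p > 1\<close> differ only in how the
    domain condition yields \<open>disc_summable\<close>, so both are treated at once.\<close>
  have lp: "bounded_shift_on w (lp_space p a b) (lp_norm p a b)"
    if "1 \<le> p" "\<And>l. l \<in> lp_seq p \<Longrightarrow> disc_summable a b l" for p
    unfolding lp_space_def
    by (rule bounded_shift_onI[where \<nu> = "\<lambda>l. (\<Sum>n. norm (l n) powr p) powr (1 / p)" and C = "suminf W",
          OF assms(1) that(2) lp_convolution_bound(1)[OF that(1) W _ U]
             lp_convolution_bound(2)[OF that(1) W _ U] lp_norm_def])
  have c0: "bounded_shift_on w (c0_space a b) (c0_norm a b)"
    if "dom_c0 a b = ball 0 1"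
    unfolding c0_space_def
    by (rule bounded_shift_onI[where \<nu> = "\<lambda>l. (SUP n. norm (l n))" and C = "suminf W",
          OF assms(1) disc_summable_c0[OF that] c0_convolution_bound(1)[OF W(1,2) _ U]
             c0_convolution_bound(2)[OF W(1,2) _ U] c0_norm_def])
  show ?thesis
    using lp c0 disc_summable_lp disc_summable_l1 by auto
qed

end
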